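(* Suppose $G$ is a finite group. There exists a shift $(X,\sigma)$ for which $\mathrm{Aut}(X)\cong G$ if and only if there exist $s\in\mathbb{N}$, integers $n_1<n_2<\cdots<n_s$, and $m_1,m_2,\dots,m_s\in\mathbb{N}$ such that $$G\cong S(n_1,m_1)\times S(n_2,m_2)\times\cdots\times S(n_s,m_s),$$ where $S(n,m)$, defined for integers $n>1$ and $m\in\mathbb{N}$, denotes the generalized symmetric group.
   Context: For a finite alphabet $\mathcal{A}$ with the discrete topology, give $\mathcal{A}^{\mathbb{Z}}$ the product topology, and let $\sigma\colon\mathcal{A}^{\mathbb{Z}}\to\mathcal{A}^{\mathbb{Z}}$ be the left shift $(\sigma x)(n)=x(n+1)$. A shift $(X,\sigma)$ is a closed, $\sigma$-invariant set $X\subseteq\mathcal{A}^{\mathbb{Z}}$ (for some finite alphabet $\mathcal{A}$) together with $\sigma$. $\mathrm{Aut}(X)$ is the group of homeomorphisms of $X$ to itself that commute with $\sigma$. For $n>1$ and $m\in\mathbb{N}$, let $\mathbb{Z}_n=\mathbb{Z}/n\mathbb{Z}$, let $\mathbb{Z}_n^m$ be the direct product of $m$ copies of $\mathbb{Z}_n$, let $S_m$ be the symmetric group on $m$ letters, and let $\psi\colon S_m\to\mathrm{Aut}(\mathbb{Z}_n^m)$ (group automorphisms) be given by $(\psi(\pi))(i_1,\dots,i_m)=(i_{\pi(1)},\dots,i_{\pi(m)})$. The generalized symmetric group is $S(n,m)=\mathbb{Z}_n^m\rtimes_{\psi}S_m$; equivalently, $S(n,m)$ is the wreath product $\mathbb{Z}_n\wr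 S_m$. Here $\mathbb{N}$ denotes the positive integers.
   Formalization: The integers n_i are allowed to equal 1, with S(1,m) the symmetric group S_m; with all n_i > 1 the claim fails, e.g. a one-point shift has trivial automorphism group, while every such product has order at least 2. *)

theory Defs
  imports "HOL-Analysis.Analysis" "HOL-Algebra.Product_Groups" "HOL-Algebra.Sym_Groups" "HOL-Algebra.Bij"
begin

section \<open>Shifts and their automorphism groups\<close>

definition shift_map :: "(int \<Rightarrow> 'a) \<Rightarrow> int \<Rightarrow> 'a"
  where "shift_map x = (\<lambda>n. x (n + 1))"

definition full_shift_topology :: "'a set \<Rightarrow> (int \<Rightarrow> 'a) topology"
  where "full_shift_topology A = product_topology (\<lambda>_. discrete_topology A) UNIV"

text \<open>Invariance means \<open>\<sigma> X = X\<close>, so that \<open>\<sigma>\<close> restricts to a homeomorphism of \<open>X\<close>.\<close>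

definition is_shift :: "'a set \<Rightarrow> (int \<Rightarrow> 'a) set \<Rightarrow> bool"
  where "is_shift A X \<longleftrightarrow>
    finite A \<and> closedin (full_shift_topology A) X \<and> shift_map ` X = X"

text \<open>As for \<^const>\<open>AutoGroup\<close>, the maps are required to be extensional (arbitrary but fixed
  outside \<open>X\<close>), so that equality of group elements is equality of maps on \<open>X\<close>.\<close>

definition shift_auts :: "'a set \<Rightarrow> (int \<Rightarrow> 'a) set \<Rightarrow> ((int \<Rightarrow> 'a) \<Rightarrow> (int \<Rightarrow> 'a)) set"
  where "shift_auts A X =
    {f \<in> Bij X.
       homeomorphic_map (subtopology (full_shift_topology A) X)
                        (subtopology (full_shift_topology A) X) f \<and>
       (\<forall>x\<in>X. f (shift_map x) = shift_map (f x))}"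

definition shift_Aut :: "'a set \<Rightarrow> (int \<Rightarrow> 'a) set \<Rightarrow> ((int \<Rightarrow> 'a) \<Rightarrow> (int \<Rightarrow> 'a)) monoid"
  where "shift_Aut A X = BijGroup X \<lparr>carrier := shift_auts A X\<rparr>"


section \<open>Generalized symmetric groups\<close>

definition semidirect_product ::
    "('a, 'c) monoid_scheme \<Rightarrow> ('b, 'd) monoid_scheme \<Rightarrow> ('b \<Rightarrow> 'a \<Rightarrow> 'a) \<Rightarrow> ('a \<times> 'b) monoid"
  where "semidirect_product N H \<phi> =
    \<lparr>carrier = carrier N \<times> carrier H,
     mult = (\<lambda>(a, g) (b, h). (a \<otimes>\<^bsub>N\<^esub> \<phi> g b, g \<otimes>\<^bsub>H\<^esub> h)),
     one = (\<one>\<^bsub>N\<^esub>, \<one>\<^bsub>H\<^esub>)\<rparr>"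

abbreviation cyclic_power :: "nat \<Rightarrow> nat \<Rightarrow> (nat \<Rightarrow> int) monoid"
  where "cyclic_power n m \<equiv> product_group {1..m} (\<lambda>_. integer_mod_group n)"

text \<open>The action \<open>\<psi> \<pi> (i\<^sub>1, \<dots>, i\<^sub>m) = (i\<^bsub>\<pi> 1\<^esub>, \<dots>, i\<^bsub>\<pi> m\<^esub>)\<close> satisfies
  \<open>\<psi> \<pi> \<circ> \<psi> \<rho> = \<psi> (\<rho> \<circ> \<pi>)\<close>. It is therefore a homomorphism when permutations are multiplied
  from left to right, whereas \<^const>\<open>sym_group\<close> multiplies them from right to left.\<close>

definition sym_group_lr :: "nat \<Rightarrow> (nat \<Rightarrow> nat) monoid"
  where "sym_group_lr m = (sym_group m) \<lparr>mult := (\<lambda>p q. q \<circ> p)\<rparr>"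

definition coord_action :: "nat \<Rightarrow> nat \<Rightarrow> (nat \<Rightarrow> nat) \<Rightarrow> (nat \<Rightarrow> int) \<Rightarrow> nat \<Rightarrow> int"
  where "coord_action n m \<pi> = (\<lambda>z \<in> carrier (cyclic_power n m). \<lambda>j\<in>{1..m}. z (\<pi> j))"

text \<open>For \<open>n = 1\<close> this is (isomorphic to) the symmetric group on \<open>m\<close> letters. The value at
  \<open>n = 0\<close> is irrelevant (\<^const>\<open>integer_mod_group\<close> is then the group of all integers).\<close>

definition gen_sym_group :: "nat \<Rightarrow> nat \<Rightarrow> ((nat \<Rightarrow> int) \<times> (nat \<Rightarrow> nat)) monoid"
  where "gen_sym_group n m =
    semidirect_product (cyclic_power n m) (sym_group_lr m) (coord_action n m)"

end

theory Submission
  imports Defs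
begin

text \<open>The powers of the shift map are automorphisms of \<open>X\<close>. If there are only finitely many
  automorphisms, two powers agree, so all points of \<open>X\<close> have a common period and \<open>X\<close> is finite.
  Topology then plays no role: \<open>X\<close> is a disjoint union of \<open>m\<^sub>i\<close> cycles of length \<open>n\<^sub>i\<close>, and its
  automorphisms are the bijections commuting with the shift. Such a bijection preserves cycle
  lengths, permutes the cycles of each length, and rotates each of them, which gives
  \<open>S(n\<^sub>i, m\<^sub>i)\<close> for every \<open>i\<close>. Conversely, any finite family of cycles is realized by a shift
  that uses a separate letter for every point.\<close>

section \<open>Bijections commuting with a self-map\<close>

text \<open>Built from \<open>BijGroup\<close> by shrinking the carrier, exactly as
  \<open>shift_Aut\<close> is, so that for a finite shift the two structures are equal and not
  merely isomorphic.\<close>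

definition commuting_bijections :: "'a set \<Rightarrow> ('a \<Rightarrow> 'a) \<Rightarrow> ('a \<Rightarrow> 'a) monoid"
  where "commuting_bijections S \<tau> =
    BijGroup S \<lparr>carrier := {f \<in> Bij S. \<forall>x\<in>S. f (\<tau> x) = \<tau> (f x)}\<rparr>"

lemma carrier_commuting_bijections:
  "f \<in> carrier (commuting_bijections S \<tau>) \<longleftrightarrow>
    f \<in> extensional S \<and> bij_betw f S S \<and> (\<forall>x\<in>S. f (\<tau> x) = \<tau> (f x))"
  by (auto simp: commuting_bijections_def Bij_def)

lemma mult_commuting_bijections:
  assumes "f \<in> carrier (commuting_bijections S \<tau>)" "g \<in> carrier (commuting_bijections S \<tau>)"
  shows "f \<otimes>\<^bsub>commuting_bijections S \<tau>\<^esub> g = compose S f g"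
  using assms by (simp add: commuting_bijections_def BijGroup_def)

text \<open>The carrier is a centralizer in the group of bijections of \<open>S\<close>. For
  inverses, write x = f y and cancel f in f (\<tau> y) = \<tau> (f y).\<close>

lemma group_commuting_bijections:
  assumes "\<tau> \<in> S \<rightarrow> S"
  shows "group (commuting_bijections S \<tau>)"
proof -
  let ?C = "{f \<in> Bij S. \<forall>x\<in>S. f (\<tau> x) = \<tau> (f x)}"
  have "subgroup ?C (BijGroup S)"
  proof (rule subgroup.intro)
    show "?C \<subseteq> carrier (BijGroup S)"
      by (auto simp: BijGroup_def)
    show "\<one>\<^bsub>BijGroup S\<^esub> \<in> ?C"
      using assms by (auto simp: BijGroup_def id_Bij)
    show "f \<otimes>\<^bsub>BijGroup S\<^esub> g \<in> ?C" if "f \<in> ?C" "g \<in> ?C" for f g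
      using that assms Bij_imp_funcset[of g S]
      by (auto simp: BijGroup_def compose_Bij compose_def Pi_iff compose_Bij[unfolded compose_def])
    show "inv\<^bsub>BijGroup S\<^esub> f \<in> ?C" if f: "f \<in> ?C" for f
    proof -
      have "inv_into S f (\<tau> x) = \<tau> (inv_into S f x)" if x: "x \<in> S" for x
      proof -
        have bij: "bij_betw f S S"
          using f by (simp add: Bij_def)
        let ?y = "inv_into S f x"
        have y: "?y \<in> S" "f ?y = x"
          using bij x f by (auto simp: Bij_inv_into_mem bij_betw_inv_into_right)
        then have "\<tau> x = f (\<tau> ?y)"
          using f by auto
        then show ?thesis
          using bij y assms by (simp add: bij_betw_inv_into_left Pi_iff)
      qed
      then show ?thesis
        using f assms by (auto simp: inv_BijGroup restrict_inv_into_Bij Pi_iff)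
    qed
  qed
  then show ?thesis
    unfolding commuting_bijections_def
    by (rule subgroup.subgroup_is_group[OF _ group_BijGroup])
qed

text \<open>The isomorphism is conjugation f \<mapsto> b f b^-1. It carries automorphism groups
  between a finite shift and its abstract model as a union of cycles.\<close>

lemma commuting_bijections_conjugate:
  assumes b: "bij_betw b S S'" and \<tau>: "\<tau> \<in> S \<rightarrow> S" and \<tau>': "\<tau>' \<in> S' \<rightarrow> S'"
    and eq: "\<And>x. x \<in> S \<Longrightarrow> b (\<tau> x) = \<tau>' (b x)"
  shows "commuting_bijections S \<tau> \<cong> commuting_bijections S' \<tau>'"
proof -
  define c where "c = inv_into S b"
  have c: "bij_betw c S' S"
    unfolding c_def by (rule bij_betw_inv_into[OF b])
  have bc: "b (c y) = y" if "y \<in> S'" for y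
    using b that by (simp add: c_def bij_betw_inv_into_right)
  have cb: "c (b x) = x" if "x \<in> S" for x
    using b that by (simp add: c_def bij_betw_inv_into_left)
  have bS: "b x \<in> S'" if "x \<in> S" for x
    using b that by (rule bij_betwE[rule_format])
  have cS: "c y \<in> S" if "y \<in> S'" for y
    using c that by (rule bij_betwE[rule_format])
  have eq': "c (\<tau>' y) = \<tau> (c y)" if "y \<in> S'" for y
    by (metis bc cS cb eq \<tau> Pi_iff that)
  \<comment> \<open>Stated for arbitrary intertwining maps \<open>u\<close> and \<open>v\<close>, so
    that it serves both for conjugation by \<open>b\<close> and for the inverse conjugation by
    \<open>c\<close>.\<close>
  have conj: "(\<lambda>y\<in>Y. u (f (v y))) \<in> carrier (commuting_bijections Y \<rho>')"
    if "f \<in> carrier (commuting_bijections Z \<rho>)" "bij_betw u Z Y" "bij_betw v Y Z"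
       "\<rho>' \<in> Y \<rightarrow> Y" "\<And>z. z \<in> Z \<Longrightarrow> u (\<rho> z) = \<rho>' (u z)" "\<And>y. y \<in> Y \<Longrightarrow> v (\<rho>' y) = \<rho> (v y)"
    for f u v \<rho> \<rho>' and Y :: "'p set" and Z :: "'q set"
  proof -
    have f: "bij_betw f Z Z" "\<And>z. z \<in> Z \<Longrightarrow> f (\<rho> z) = \<rho> (f z)"
      using that(1) by (auto simp: carrier_commuting_bijections)
    have "bij_betw (u \<circ> (f \<circ> v)) Y Y"
      using bij_betw_trans[OF bij_betw_trans[OF that(3) f(1)] that(2)] by (simp add: o_assoc)
    then have "bij_betw (\<lambda>y\<in>Y. u (f (v y))) Y Y"
      by (rule bij_betw_cong[THEN iffD1, rotated]) auto
    moreover have "v y \<in> Z" "f (v y) \<in> Z" if "y \<in> Y" for y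
      using that \<open>bij_betw v Y Z\<close> f(1) by (auto dest!: bij_betwE)
    ultimately show ?thesis
      using that(4-6) f(2) by (auto simp: carrier_commuting_bijections Pi_iff)
  qed
  have "(\<lambda>f. \<lambda>y\<in>S'. b (f (c y))) \<in> iso (commuting_bijections S \<tau>) (commuting_bijections S' \<tau>')"
    unfolding iso_def hom_def mem_Collect_eq
  proof (intro conjI ballI)
    show maps: "(\<lambda>f. \<lambda>y\<in>S'. b (f (c y)))
        \<in> carrier (commuting_bijections S \<tau>) \<rightarrow> carrier (commuting_bijections S' \<tau>')"
      using conj[OF _ b c \<tau>' eq eq'] by blast
    have maps': "(\<lambda>g. \<lambda>x\<in>S. c (g (b x)))
        \<in> carrier (commuting_bijections S' \<tau>') \<rightarrow> carrier (commuting_bijections S \<tau>)"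
      using conj[OF _ c b \<tau> eq' eq] by blast
    show "bij_betw (\<lambda>f. \<lambda>y\<in>S'. b (f (c y)))
        (carrier (commuting_bijections S \<tau>)) (carrier (commuting_bijections S' \<tau>'))"
    proof (rule bij_betwI[OF maps maps'])
      fix f assume "f \<in> carrier (commuting_bijections S \<tau>)"
      then have "f \<in> extensional S" "f \<in> S \<rightarrow> S"
        by (auto simp: carrier_commuting_bijections bij_betw_imp_funcset)
      then show "(\<lambda>x\<in>S. c ((\<lambda>y\<in>S'. b (f (c y))) (b x))) = f"
        by (intro extensionalityI[of _ S]) (auto simp: bS cb Pi_iff)
    next
      fix g assume "g \<in> carrier (commuting_bijections S' \<tau>')"
      then have "g \<in> extensional S'" "g \<in> S' \<rightarrow> S'"
        by (auto simp: carrier_commuting_bijections bij_betw_imp_funcset)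
      then show "(\<lambda>y\<in>S'. b ((\<lambda>x\<in>S. c (g (b x))) (c y))) = g"
        by (intro extensionalityI[of _ S']) (auto simp: cS bc Pi_iff)
    qed
    fix f g assume fg: "f \<in> carrier (commuting_bijections S \<tau>)" "g \<in> carrier (commuting_bijections S \<tau>)"
    have "g (c y) \<in> S" if "y \<in> S'" for y
      using fg(2) cS[OF that] by (auto simp: carrier_commuting_bijections dest: bij_betwE)
    then show "(\<lambda>y\<in>S'. b ((f \<otimes>\<^bsub>commuting_bijections S \<tau>\<^esub> g) (c y))) =
        (\<lambda>y\<in>S'. b (f (c y))) \<otimes>\<^bsub>commuting_bijections S' \<tau>'\<^esub> (\<lambda>y\<in>S'. b (g (c y)))"
      using fg maps by (auto simp: mult_commuting_bijections Pi_iff compose_def bS cS cb)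
  qed
  then show ?thesis
    by (rule is_isoI)
qed

text \<open>Inversion in \<open>K\<close> reverses products, and so does the inverse of \<phi>; in
  their composite the two reversals cancel. The group axioms are asked of \<open>K\<close> alone: in
  the application \<open>H\<close> is a product of generalized symmetric groups, for which only
  closure is then checked.\<close>

lemma iso_of_anti_iso:
  assumes K: "group K"
    and \<phi>: "bij_betw \<phi> (carrier H) (carrier K)"
    and closed: "\<And>x y. \<lbrakk>x \<in> carrier H; y \<in> carrier H\<rbrakk> \<Longrightarrow> x \<otimes>\<^bsub>H\<^esub> y \<in> carrier H"
    and anti: "\<And>x y. \<lbrakk>x \<in> carrier H; y \<in> carrier H\<rbrakk> \<Longrightarrow> \<phi> (x \<otimes>\<^bsub>H\<^esub> y) = \<phi> y \<otimes>\<^bsub>K\<^esub> \<phi> x"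
  shows "K \<cong> H"
proof -
  interpret K: group K by (rule K)
  define \<psi> where "\<psi> = inv_into (carrier H) \<phi>"
  have \<psi>: "\<psi> k \<in> carrier H" "\<phi> (\<psi> k) = k" if "k \<in> carrier K" for k
    using \<phi> that bij_betw_inv_into[OF \<phi>]
    by (auto simp: \<psi>_def bij_betw_inv_into_right dest: bij_betwE)
  have \<psi>_anti: "\<psi> (k \<otimes>\<^bsub>K\<^esub> l) = \<psi> l \<otimes>\<^bsub>H\<^esub> \<psi> k" if "k \<in> carrier K" "l \<in> carrier K" for k l
  proof -
    have "\<phi> (\<psi> l \<otimes>\<^bsub>H\<^esub> \<psi> k) = k \<otimes>\<^bsub>K\<^esub> l"
      using that by (simp add: anti \<psi>)
    then show ?thesis
      unfolding \<psi>_def using \<phi> closed \<psi> that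
      by (metis \<psi>_def bij_betw_inv_into_left)
  qed
  have bij: "bij_betw (\<psi> \<circ> (\<lambda>k. inv\<^bsub>K\<^esub> k)) (carrier K) (carrier H)"
  proof (rule bij_betw_trans)
    show "bij_betw (\<lambda>k. inv\<^bsub>K\<^esub> k) (carrier K) (carrier K)"
      by (rule bij_betw_byWitness[where f' = "\<lambda>k. inv\<^bsub>K\<^esub> k"]) auto
    show "bij_betw \<psi> (carrier K) (carrier H)"
      unfolding \<psi>_def by (rule bij_betw_inv_into[OF \<phi>])
  qed
  have "\<psi> \<circ> (\<lambda>k. inv\<^bsub>K\<^esub> k) \<in> iso K H"
    unfolding iso_def hom_def using bij
    by (auto simp: \<psi> \<psi>_anti K.inv_mult_group)
  then show ?thesis
    by (rule is_isoI)
qed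

lemma singleton_groups_iso:
  assumes "group G" "group H" "card (carrier G) = 1" "card (carrier H) = 1"
  shows "G \<cong> H"
proof -
  have "carrier G = {\<one>\<^bsub>G\<^esub>}" "carrier H = {\<one>\<^bsub>H\<^esub>}"
    using assms by (metis card_1_singletonE group.is_monoid monoid.one_closed singletonD)+
  then have "(\<lambda>_. \<one>\<^bsub>H\<^esub>) \<in> iso G H"
    using assms(2) by (auto simp: iso_def hom_def bij_betw_def group.is_monoid monoid.r_one)
  then show ?thesis
    by (rule is_isoI)
qed

section \<open>Disjoint unions of cycles\<close>

text \<open>A point (i, j, k) is position k on the j-th cycle of length \<open>n i\<close>.
  Positions are integers so that they are literally the elements of
  \<open>integer_mod_group (n i)\<close> when \<open>n i\<close> is positive.\<close>

definition cycle_model :: "nat \<Rightarrow> (nat \<Rightarrow> nat) \<Rightarrow> (nat \<Rightarrow> nat) \<Rightarrow> (nat \<times> nat \<times> int) set"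
  where "cycle_model s n m = (SIGMA i:{1..s}. {1..m i} \<times> {0..<int (n i)})"

definition cycle_step :: "(nat \<Rightarrow> nat) \<Rightarrow> nat \<times> nat \<times> int \<Rightarrow> nat \<times> nat \<times> int"
  where "cycle_step n = (\<lambda>(i, j, k). (i, j, (k + 1) mod int (n i)))"

lemma cycle_step_in: "cycle_step n \<in> cycle_model s n m \<rightarrow> cycle_model s n m"
  by (auto simp: cycle_model_def cycle_step_def)

text \<open>The bounds on \<open>k\<close> serve the case d = 0, where the right-hand side reduces
  \<open>k\<close> modulo \<open>n i\<close> although no step is taken.\<close>

lemma cycle_step_funpow:
  assumes "0 \<le> k" "k < int (n i)"
  shows "(cycle_step n ^^ d) (i, j, k) = (i, j, (k + int d) mod int (n i))"
  using assms by (induction d) (auto simp: cycle_step_def mod_simps ac_simps)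

text \<open>The components of \<^const>\<open>gen_sym_group\<close> multiply from left to right, so this is a right
  action, and composition of maps turns it into an anti-homomorphism.\<close>

definition cycle_act ::
    "nat \<Rightarrow> (nat \<Rightarrow> nat) \<Rightarrow> (nat \<Rightarrow> nat) \<Rightarrow> (nat \<Rightarrow> (nat \<Rightarrow> int) \<times> (nat \<Rightarrow> nat)) \<Rightarrow>
      nat \<times> nat \<times> int \<Rightarrow> nat \<times> nat \<times> int"
  where "cycle_act s n m p =
    (\<lambda>(i, j, k) \<in> cycle_model s n m. (i, snd (p i) j, (k + fst (p i) j) mod int (n i)))"

section \<open>Products of generalized symmetric groups acting on cycles\<close>

abbreviation gen_sym_product ::
    "nat \<Rightarrow> (nat \<Rightarrow> nat) \<Rightarrow> (nat \<Rightarrow> nat) \<Rightarrow> (nat \<Rightarrow> (nat \<Rightarrow> int) \<times> (nat \<Rightarrow> nat)) monoid"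
  where "gen_sym_product s n m \<equiv> product_group {1..s} (\<lambda>i. gen_sym_group (n i) (m i))"

lemma carrier_gen_sym_group:
  assumes "n \<ge> 1"
  shows "carrier (gen_sym_group n m) = ({1..m} \<rightarrow>\<^sub>E {0..<int n}) \<times> {\<pi>. \<pi> permutes {1..m}}"
  using assms
  by (auto simp: gen_sym_group_def semidirect_product_def sym_group_lr_def sym_group_def
      carrier_integer_mod_group)

text \<open>The second factor has to lie in the cyclic power because \<open>coord_action\<close> is
  restricted to that carrier.\<close>

lemma mult_gen_sym_group:
  assumes "n \<ge> 1" "b \<in> {1..m} \<rightarrow>\<^sub>E {0..<int n}"
  shows "(a, \<pi>) \<otimes>\<^bsub>gen_sym_group n m\<^esub> (b, \<rho>) = ((\<lambda>j\<in>{1..m}. (a j + b (\<pi> j)) mod int n), \<rho> \<circ> \<pi>)"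
  using assms
  by (auto simp: gen_sym_group_def semidirect_product_def sym_group_lr_def coord_action_def
      carrier_integer_mod_group)

lemma gen_sym_product_closed:
  assumes n: "\<forall>i\<in>{1..s}. n i \<ge> 1"
    and p: "p \<in> carrier (gen_sym_product s n m)" and q: "q \<in> carrier (gen_sym_product s n m)"
  shows "p \<otimes>\<^bsub>gen_sym_product s n m\<^esub> q \<in> carrier (gen_sym_product s n m)"
proof -
  have "p i \<otimes>\<^bsub>gen_sym_group (n i) (m i)\<^esub> q i \<in> carrier (gen_sym_group (n i) (m i))"
    if i: "i \<in> {1..s}" for i
  proof -
    obtain a \<pi> b \<rho> where pq: "p i = (a, \<pi>)" "q i = (b, \<rho>)"
      by (metis surj_pair)
    have "p i \<in> carrier (gen_sym_group (n i) (m i))" "q i \<in> carrier (gen_sym_group (n i) (m i))"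
      using p q i by (auto simp: PiE_iff)
    then show ?thesis
      unfolding pq using bspec[OF n i]
      by (auto simp: carrier_gen_sym_group mult_gen_sym_group permutes_compose)
  qed
  then show ?thesis
    by simp
qed

lemma gen_sym_product_component:
  assumes "\<forall>i\<in>{1..s}. n i \<ge> 1" "p \<in> carrier (gen_sym_product s n m)" "i \<in> {1..s}"
  shows "fst (p i) \<in> {1..m i} \<rightarrow>\<^sub>E {0..<int (n i)}" "snd (p i) permutes {1..m i}"
proof -
  have "p i \<in> carrier (gen_sym_group (n i) (m i))"
    using assms by (auto simp: PiE_iff)
  then show "fst (p i) \<in> {1..m i} \<rightarrow>\<^sub>E {0..<int (n i)}" "snd (p i) permutes {1..m i}"
    using assms by (auto simp: carrier_gen_sym_group)
qed

text \<open>Let p and q have components (a, \<pi>) and (b, \<rho>) at i. Acting by p and then by q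
  moves cycle j to \<rho> (\<pi> j) and adds a j + b (\<pi> j) to the position, which is the
  semidirect product formula.\<close>

lemma cycle_act_mult:
  assumes n: "\<forall>i\<in>{1..s}. n i \<ge> 1"
    and p: "p \<in> carrier (gen_sym_product s n m)" and q: "q \<in> carrier (gen_sym_product s n m)"
  shows "cycle_act s n m (p \<otimes>\<^bsub>gen_sym_product s n m\<^esub> q) =
    compose (cycle_model s n m) (cycle_act s n m q) (cycle_act s n m p)"
proof
  fix x
  show "cycle_act s n m (p \<otimes>\<^bsub>gen_sym_product s n m\<^esub> q) x =
    compose (cycle_model s n m) (cycle_act s n m q) (cycle_act s n m p) x"
  proof (cases "x \<in> cycle_model s n m")
    case True
    then obtain i j k where x: "x = (i, j, k)" and i: "i \<in> {1..s}" and j: "j \<in> {1..m i}"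
      and k: "k \<in> {0..<int (n i)}"
      by (auto simp: cycle_model_def)
    note pc = gen_sym_product_component[OF n p i] and qc = gen_sym_product_component[OF n q i]
    have \<pi>j: "snd (p i) j \<in> {1..m i}"
      using pc(2) j by (metis permutes_in_image)
    have "p i \<otimes>\<^bsub>gen_sym_group (n i) (m i)\<^esub> q i =
      ((\<lambda>j\<in>{1..m i}. (fst (p i) j + fst (q i) (snd (p i) j)) mod int (n i)), snd (q i) \<circ> snd (p i))"
      using mult_gen_sym_group[OF bspec[OF n i] qc(1), of "fst (p i)" "snd (p i)" "snd (q i)"] by simp
    then show ?thesis
      using True i j k \<pi>j bspec[OF n i]
      by (simp add: x cycle_act_def compose_def cycle_model_def mod_simps ac_simps)
  next
    case False
    then show ?thesis
      by (simp add: cycle_act_def compose_def)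
  qed
qed

text \<open>Injectivity suffices for bijectivity because the model is finite. From an image point
  the permutation recovers the cycle, and subtracting the rotation recovers the position modulo
  \<open>n i\<close>.\<close>

lemma cycle_act_in_carrier:
  assumes n: "\<forall>i\<in>{1..s}. n i \<ge> 1"
    and p: "p \<in> carrier (gen_sym_product s n m)"
  shows "cycle_act s n m p \<in> carrier (commuting_bijections (cycle_model s n m) (cycle_step n))"
    (is "?f \<in> _")
proof -
  let ?T = "cycle_model s n m"
  note comp = gen_sym_product_component[OF n p]
  have perm: "snd (p i) j \<in> {1..m i}" if "i \<in> {1..s}" "j \<in> {1..m i}" for i j
    using comp(2)[OF that(1)] that(2) by (metis permutes_in_image)
  have f: "?f (i, j, k) = (i, snd (p i) j, (k + fst (p i) j) mod int (n i))"
    if "(i, j, k) \<in> ?T" for i j k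
    using that by (simp add: cycle_act_def)
  have maps: "?f ` ?T \<subseteq> ?T"
    using perm n by (fastforce simp: cycle_act_def cycle_model_def)
  have "inj_on ?f ?T"
  proof (rule inj_onI)
    fix x y assume xy: "x \<in> ?T" "y \<in> ?T" "?f x = ?f y"
    obtain i j k i' j' k' where x: "x = (i, j, k)" and y: "y = (i', j', k')"
      by (metis surj_pair)
    have T: "(i, j, k) \<in> ?T" "(i', j', k') \<in> ?T" and eq: "?f (i, j, k) = ?f (i', j', k')"
      using xy by (simp_all add: x y)
    have i: "i' = i" "i \<in> {1..s}"
      using eq T by (auto simp: f cycle_model_def)
    have "snd (p i) j = snd (p i) j'"
      using eq T i by (simp add: f)
    then have j: "j' = j"
      using comp(2)[OF i(2)] by (metis permutes_inj injD)
    have "(k + fst (p i) j) mod int (n i) = (k' + fst (p i) j) mod int (n i)"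
      using eq T i j by (simp add: f)
    then have "k mod int (n i) = k' mod int (n i)"
      by (metis add_diff_cancel_right' mod_diff_left_eq)
    then have "k' = k"
      using T i by (simp add: cycle_model_def)
    then show "x = y"
      using i j by (simp add: x y)
  qed
  moreover have "finite ?T"
    by (auto simp: cycle_model_def)
  ultimately have "bij_betw ?f ?T ?T"
    using maps by (simp add: bij_betw_def endo_inj_surj)
  moreover have "?f (cycle_step n x) = cycle_step n (?f x)" if x: "x \<in> ?T" for x
  proof -
    have "cycle_step n x \<in> ?T"
      using cycle_step_in x by blast
    then show ?thesis
      using x by (cases x) (auto simp: cycle_step_def f mod_simps ac_simps)
  qed
  ultimately show ?thesis
    by (auto simp: carrier_commuting_bijections cycle_act_def)
qed

text \<open>The images of the base points (i, j, 0) display the rotation amounts, already reduced,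
  and the permutation. Outside {1..m i} both are fixed by convention: rotations are extensional and
  permutations are the identity.\<close>

lemma inj_on_cycle_act:
  assumes n: "\<forall>i\<in>{1..s}. n i \<ge> 1"
  shows "inj_on (cycle_act s n m) (carrier (gen_sym_product s n m))"
proof (rule inj_onI)
  fix p q
  assume p: "p \<in> carrier (gen_sym_product s n m)" and q: "q \<in> carrier (gen_sym_product s n m)"
    and eq: "cycle_act s n m p = cycle_act s n m q"
  have "p i = q i" if i: "i \<in> {1..s}" for i
  proof (rule prod_eqI)
    note pc = gen_sym_product_component[OF n p i] and qc = gen_sym_product_component[OF n q i]
    have *: "fst (p i) j = fst (q i) j \<and> snd (p i) j = snd (q i) j" if j: "j \<in> {1..m i}" for j
    proof -
      have "(i, j, 0) \<in> cycle_model s n m"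
        using i j bspec[OF n i] by (simp add: cycle_model_def)
      moreover have "fst (p i) j \<in> {0..<int (n i)}" "fst (q i) j \<in> {0..<int (n i)}"
        using pc(1) qc(1) j by (auto simp: PiE_iff)
      ultimately show ?thesis
        using fun_cong[OF eq, of "(i, j, 0)"] by (simp add: cycle_act_def)
    qed
    show "fst (p i) = fst (q i)"
      using pc(1) qc(1) * by (intro PiE_ext) auto
    show "snd (p i) = snd (q i)"
      using * permutes_not_in[OF pc(2)] permutes_not_in[OF qc(2)] by (metis ext)
  qed
  then show "p = q"
    using p q by (intro PiE_ext[of p "{1..s}"]) auto
qed

text \<open>A map commuting with the step is determined by its values at the base points (i, j, 0),
  from which the permutations and rotations are read off. Injectivity of \<open>n\<close> excludes
  exchanging cycles that have different indices i but equal lengths.\<close>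

lemma cycle_act_surj:
  assumes n: "\<forall>i\<in>{1..s}. n i \<ge> 1" and inj: "inj_on n {1..s}"
    and f: "f \<in> carrier (commuting_bijections (cycle_model s n m) (cycle_step n))"
  shows "f \<in> cycle_act s n m ` carrier (gen_sym_product s n m)"
proof -
  let ?T = "cycle_model s n m"
  have bij: "bij_betw f ?T ?T" and ext: "f \<in> extensional ?T"
    and step: "\<And>x. x \<in> ?T \<Longrightarrow> f (cycle_step n x) = cycle_step n (f x)"
    using f by (auto simp: carrier_commuting_bijections)
  have pow_in: "(cycle_step n ^^ d) x \<in> ?T" if "x \<in> ?T" for d x
    using that by (induction d) (use cycle_step_in[of n s m] in auto)
  have pow: "f ((cycle_step n ^^ d) x) = (cycle_step n ^^ d) (f x)" if "x \<in> ?T" for d x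
    using that by (induction d) (auto simp: step pow_in)
  have fT: "f x \<in> ?T" if "x \<in> ?T" for x
    using bij that by (rule bij_betwE[rule_format])
  have base: "(i, j, 0) \<in> ?T" if "i \<in> {1..s}" "j \<in> {1..m i}" for i j
    using that bspec[OF n, of i] by (simp add: cycle_model_def)
  define g where "g i j = fst (snd (f (i, j, 0)))" for i j
  define a where "a i j = snd (snd (f (i, j, 0)))" for i j
  \<comment> \<open>The cycle lengths are distinct, and the length of the cycle through a point is its least
    period, which \<open>f\<close> preserves.\<close>
  have f0: "f (i, j, 0) = (i, g i j, a i j) \<and> g i j \<in> {1..m i} \<and> a i j \<in> {0..<int (n i)}"
    if i: "i \<in> {1..s}" and j: "j \<in> {1..m i}" for i j
  proof -
    obtain i' j' k' where f': "f (i, j, 0) = (i', j', k')"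
      by (metis surj_pair)
    then have T': "i' \<in> {1..s}" "j' \<in> {1..m i'}" "k' \<in> {0..<int (n i')}"
      using fT[OF base[OF i j]] by (auto simp: cycle_model_def)
    \<comment> \<open>A point returns after d steps exactly when its cycle length divides d. Here
      the return of the base point is pushed forward along f; below, the return of its image is
      pulled back by injectivity of f, so the two lengths divide each other.\<close>
    have "(cycle_step n ^^ n i) (i', j', k') = f ((cycle_step n ^^ n i) (i, j, 0))"
      using pow[OF base[OF i j]] f' by simp
    also have "(cycle_step n ^^ n i) (i, j, 0) = (i, j, 0)"
      using bspec[OF n i] by (simp add: cycle_step_funpow)
    finally have "(k' + int (n i)) mod int (n i') = k' mod int (n i')"
      using T' f' by (simp add: cycle_step_funpow)
    then have "int (n i') dvd int (n i)"
      by (metis add_diff_cancel_left' mod_eq_dvd_iff)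
    moreover have "int (n i) dvd int (n i')"
    proof -
      have "f ((cycle_step n ^^ n i') (i, j, 0)) = (cycle_step n ^^ n i') (i', j', k')"
        using pow[OF base[OF i j]] f' by simp
      also have "\<dots> = f (i, j, 0)"
        using T' f' by (simp add: cycle_step_funpow)
      finally have "(cycle_step n ^^ n i') (i, j, 0) = (i, j, 0)"
        using bij_betw_imp_inj_on[OF bij] pow_in[OF base[OF i j]] base[OF i j]
        by (auto dest: inj_onD)
      then show ?thesis
        using bspec[OF n i] by (auto simp: cycle_step_funpow)
    qed
    ultimately have "n i = n i'"
      by (simp add: dvd_antisym)
    then have "i' = i"
      using inj i T' by (auto dest: inj_onD)
    then show ?thesis
      using T' f' by (simp add: g_def a_def)
  qed
  have fk: "f (i, j, k) = (i, g i j, (k + a i j) mod int (n i))"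
    if i: "i \<in> {1..s}" and j: "j \<in> {1..m i}" and k: "k \<in> {0..<int (n i)}" for i j k
  proof -
    have "(i, j, k) = (cycle_step n ^^ nat k) (i, j, 0)"
      using bspec[OF n i] k by (simp add: cycle_step_funpow)
    then show ?thesis
      using pow[OF base[OF i j], of "nat k"] f0[OF i j] k
      by (simp add: cycle_step_funpow add.commute)
  qed
  have g_inj: "inj_on (g i) {1..m i}" if i: "i \<in> {1..s}" for i
  proof (rule inj_onI)
    fix j j' assume j: "j \<in> {1..m i}" "j' \<in> {1..m i}" and eq: "g i j = g i j'"
    \<comment> \<open>If two cycles had the same target cycle, this position on the first would have
      the same image as the base point of the second.\<close>
    define k where "k = (a i j' - a i j) mod int (n i)"
    have k: "k \<in> {0..<int (n i)}"
      using bspec[OF n i] by (simp add: k_def)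
    have "(k + a i j) mod int (n i) = a i j'"
      using f0[OF i j(2)] by (simp add: k_def mod_simps)
    then have "f (i, j, k) = f (i, j', 0)"
      using fk[OF i j(1) k] f0[OF i j(2)] eq by simp
    moreover have "(i, j, k) \<in> ?T"
      using i j k by (simp add: cycle_model_def)
    ultimately have "(i, j, k) = (i, j', 0)"
      using bij_betw_imp_inj_on[OF bij] base[OF i j(2)] by (auto dest: inj_onD)
    then show "j = j'"
      by simp
  qed
  define p where "p = (\<lambda>i\<in>{1..s}. ((\<lambda>j\<in>{1..m i}. a i j), (\<lambda>j. if j \<in> {1..m i} then g i j else j)))"
  have "(\<lambda>j. if j \<in> {1..m i} then g i j else j) permutes {1..m i}" if i: "i \<in> {1..s}" for i
  proof (rule bij_imp_permutes)
    have "g i ` {1..m i} = {1..m i}"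
      using f0[OF i] g_inj[OF i] by (intro endo_inj_surj) auto
    then have "bij_betw (g i) {1..m i} {1..m i}"
      using g_inj[OF i] by (simp add: bij_betw_def)
    then show "bij_betw (\<lambda>j. if j \<in> {1..m i} then g i j else j) {1..m i} {1..m i}"
      by (rule bij_betw_cong[THEN iffD1, rotated]) auto
  qed auto
  then have "p \<in> carrier (gen_sym_product s n m)"
    using f0 n by (auto simp: p_def carrier_gen_sym_group)
  moreover have "f = cycle_act s n m p"
  proof (rule extensionalityI[OF ext])
    show "cycle_act s n m p \<in> extensional ?T"
      by (simp add: cycle_act_def)
    show "f x = cycle_act s n m p x" if "x \<in> ?T" for x
      using that by (auto simp: cycle_act_def cycle_model_def p_def fk)
  qed
  ultimately show ?thesis
    by blast
qed

lemma commuting_bijections_cycle_model: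
  assumes n: "\<forall>i\<in>{1..s}. n i \<ge> 1" and inj: "inj_on n {1..s}"
  shows "commuting_bijections (cycle_model s n m) (cycle_step n) \<cong> gen_sym_product s n m"
proof (rule iso_of_anti_iso)
  show "group (commuting_bijections (cycle_model s n m) (cycle_step n))"
    by (rule group_commuting_bijections[OF cycle_step_in])
  show "bij_betw (cycle_act s n m) (carrier (gen_sym_product s n m))
      (carrier (commuting_bijections (cycle_model s n m) (cycle_step n)))"
    unfolding bij_betw_def
    using inj_on_cycle_act[OF n] cycle_act_in_carrier[OF n] cycle_act_surj[OF n inj] by blast
qed (use n in \<open>simp_all only: gen_sym_product_closed cycle_act_mult mult_commuting_bijections
    cycle_act_in_carrier\<close>)

section \<open>Decomposition of a finite periodic system into cycles\<close>

definition least_period :: "('a \<Rightarrow> 'a) \<Rightarrow> 'a \<Rightarrow> nat"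
  where "least_period \<tau> x = (LEAST d. d > 0 \<and> (\<tau> ^^ d) x = x)"

text \<open>The distinct least periods, listed in increasing order, give \<open>n\<close>. Choosing
  one representative in each orbit and counting those of period \<open>n i\<close> gives
  \<open>m i\<close>. The map \<open>b\<close> sends (i, j, k) to the k-th iterate of the j-th
  representative of period \<open>n i\<close>.\<close>

lemma cycle_model_exists:
  fixes \<tau> :: "'a \<Rightarrow> 'a"
  assumes fin: "finite X" and ne: "X \<noteq> {}" and \<tau>: "\<tau> \<in> X \<rightarrow> X" 
    and N: "N > 0" "\<And>x. x \<in> X \<Longrightarrow> (\<tau> ^^ N) x = x"
  obtains s n m b where "s \<ge> 1" "strict_mono_on {1..s} n" "\<forall>i\<in>{1..s}. n i \<ge> 1 \<and> m i \<ge> 1"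
    "bij_betw b (cycle_model s n m) X"
    "\<And>x. x \<in> cycle_model s n m \<Longrightarrow> b (cycle_step n x) = \<tau> (b x)"
proof -
  define per where "per = least_period \<tau>"
  have pow_in: "(\<tau> ^^ d) x \<in> X" if "x \<in> X" for d x
    using that by (induction d) (use \<tau> in auto)
  have per: "per x > 0" "(\<tau> ^^ per x) x = x" if "x \<in> X" for x
    using LeastI[of "\<lambda>d. d > 0 \<and> (\<tau> ^^ d) x = x" N] N(1) N(2)[OF that]
    by (auto simp: per_def least_period_def)
  have per_le: "per x \<le> d" if "d > 0" "(\<tau> ^^ d) x = x" for d x
    unfolding per_def least_period_def using that by (intro Least_le) auto
  have pow_mod: "(\<tau> ^^ d) x = (\<tau> ^^ (d mod per x)) x" if "x \<in> X" for d x
    using funpow_mod_eq[OF per(2)[OF that]] by metis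
  \<comment> \<open>After d steps, a further d * N - d steps complete d full periods. Forward
    iteration alone thus leads back to the start, so forward orbits are already the cycles.\<close>
  have return: "\<exists>e. (\<tau> ^^ e) ((\<tau> ^^ d) x) = x" if x: "x \<in> X" for d x
  proof -
    have "(\<tau> ^^ (d * N)) x = x"
      using N(2)[OF x] by (induction d) (auto simp: funpow_add)
    moreover have "d * N = (d * N - d) + d"
      using N(1) by simp
    ultimately show ?thesis
      by (metis comp_apply funpow_add)
  qed
  have per_pow: "per ((\<tau> ^^ d) x) = per x" if x: "x \<in> X" for d x
  proof -
    have le: "per ((\<tau> ^^ d) x) \<le> per x" if x: "x \<in> X" for d x
    proof (rule per_le[OF per(1)[OF x]])
      have "(\<tau> ^^ per x) ((\<tau> ^^ d) x) = (\<tau> ^^ d) ((\<tau> ^^ per x) x)"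
        by (metis add.commute comp_apply funpow_add)
      then show "(\<tau> ^^ per x) ((\<tau> ^^ d) x) = (\<tau> ^^ d) x"
        by (simp add: per(2)[OF x])
    qed
    obtain e where "(\<tau> ^^ e) ((\<tau> ^^ d) x) = x"
      using return[OF x] by blast
    then show ?thesis
      using le[OF x, of d] le[OF pow_in[OF x], of e d] by simp
  qed
  define orb where "orb x = {(\<tau> ^^ d) x | d. True}" for x
  have orb_sub: "orb ((\<tau> ^^ d) x) \<subseteq> orb x" for d x
    unfolding orb_def by (auto simp flip: comp_apply[of "\<tau> ^^ _" "\<tau> ^^ _"] funpow_add)
  have orb_pow: "orb ((\<tau> ^^ d) x) = orb x" if "x \<in> X" for d x
    using orb_sub return[OF that] by (metis subset_antisym)
  have self: "x \<in> orb x" for x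
    unfolding orb_def by (auto intro: exI[of _ 0])
  \<comment> \<open>The choice depends only on the set \<open>orb x\<close>, so all points of one
    orbit receive the same representative.\<close>
  define rep where "rep x = (SOME y. y \<in> orb x)" for x
  have rep: "rep x \<in> orb x" for x
    unfolding rep_def using self by (rule someI)
  have rep_pow: "\<exists>d. x = (\<tau> ^^ d) (rep x)" "rep x \<in> X" if x: "x \<in> X" for x
  proof -
    obtain d where "rep x = (\<tau> ^^ d) x"
      using rep[of x] by (auto simp: orb_def)
    then show "\<exists>d. x = (\<tau> ^^ d) (rep x)" "rep x \<in> X"
      using return[OF x, of d] pow_in[OF x] by metis+
  qed
  have rep_eq: "rep ((\<tau> ^^ d) x) = rep x" if "x \<in> X" for d x
    using that by (simp add: rep_def orb_pow)
  define R where "R = rep ` X"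
  have R: "r \<in> X" "rep r = r" if r: "r \<in> R" for r
  proof -
    obtain x where x: "x \<in> X" "r = rep x"
      using r by (auto simp: R_def)
    then show "r \<in> X"
      by (simp add: rep_pow)
    then show "rep r = r"
      using x rep_pow(1)[OF x(1)] rep_eq by metis
  qed
  define P where "P = per ` X"
  define s where "s = card P"
  \<comment> \<open>The offset converts indices starting at 1 to list positions starting at
    0.\<close>
  define n where "n i = sorted_list_of_set P ! (i - 1)" for i
  have P: "finite P" "P \<noteq> {}"
    using fin ne by (auto simp: P_def)
  have n_mono: "strict_mono_on {1..s} n"
    using strict_sorted_list_of_set[of P] P
    by (intro strict_mono_onI) (auto simp: n_def s_def sorted_wrt_iff_nth_less)
  have n_image: "n ` {1..s} = P"
  proof -
    have "P = set (sorted_list_of_set P)"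
      using P by simp
    also have "\<dots> = (!) (sorted_list_of_set P) ` {..<s}"
      unfolding set_conv_nth by (auto simp: s_def)
    also have "{..<s} = (\<lambda>i. i - 1) ` {1..s}"
      by (force simp: image_iff intro: bexI[of _ "Suc _"])
    finally show ?thesis
      by (simp add: image_image n_def)
  qed
  define Rn where "Rn i = {r \<in> R. per r = n i}" for i
  define m where "m i = card (Rn i)" for i
  have fin_Rn: "finite (Rn i)" for i
    using fin by (simp add: Rn_def R_def)
  have "\<forall>i. \<exists>h. bij_betw h {1..m i} (Rn i)"
    using ex_bij_betw_nat_finite_1[OF fin_Rn] by (simp add: m_def)
  then obtain h where h: "\<And>i. bij_betw (h i) {1..m i} (Rn i)"
    by metis
  define b where "b = (\<lambda>(i, j, k). (\<tau> ^^ nat k) (h i j))"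
  have hR: "h i j \<in> R" "per (h i j) = n i" "h i j \<in> X" if "j \<in> {1..m i}" for i j
    using bij_betwE[OF h[of i]] that R by (auto simp: Rn_def)
  show thesis
  proof
    show "s \<ge> 1"
      using P by (simp add: s_def Suc_le_eq card_gt_0_iff)
    show "strict_mono_on {1..s} n"
      by (rule n_mono)
    show "\<forall>i\<in>{1..s}. n i \<ge> 1 \<and> m i \<ge> 1"
    proof
      fix i assume "i \<in> {1..s}"
      then have "n i \<in> P"
        using n_image by blast
      then obtain x where x: "x \<in> X" "n i = per x"
        by (auto simp: P_def)
      obtain d where "x = (\<tau> ^^ d) (rep x)"
        using rep_pow(1)[OF x(1)] by blast
      then have "per (rep x) = n i"
        using x(2) per_pow[OF rep_pow(2)[OF x(1)]] by metis
      then have "rep x \<in> Rn i"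
        using x(1) by (simp add: Rn_def R_def)
      then have "m i \<noteq> 0"
        using fin_Rn by (auto simp: m_def)
      then show "n i \<ge> 1 \<and> m i \<ge> 1"
        using x per(1)[OF x(1)] by simp
    qed
    show "bij_betw b (cycle_model s n m) X"
      unfolding bij_betw_def
    proof
      show "inj_on b (cycle_model s n m)"
      proof (rule inj_onI)
        fix x y assume xy: "x \<in> cycle_model s n m" "y \<in> cycle_model s n m" "b x = b y"
        obtain i j k i' j' k' where x: "x = (i, j, k)" and y: "y = (i', j', k')"
          by (metis surj_pair)
        have T: "i \<in> {1..s}" "j \<in> {1..m i}" "k \<in> {0..<int (n i)}"
            "i' \<in> {1..s}" "j' \<in> {1..m i'}" "k' \<in> {0..<int (n i')}"
          and eq: "(\<tau> ^^ nat k) (h i j) = (\<tau> ^^ nat k') (h i' j')"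
          using xy by (auto simp: x y cycle_model_def b_def)
        have hh: "h i j = h i' j'"
          using hR(1,3)[OF T(2)] hR(1,3)[OF T(5)] eq by (metis R(2) rep_eq)
        then have "n i = n i'"
          using hR(2) T by metis
        then have i: "i = i'"
          using n_mono T by (metis strict_mono_on_imp_inj_on inj_onD)
        then have j: "j = j'"
          using hh h[of i] T by (auto simp: bij_betw_def dest: inj_onD)
        \<comment> \<open>If k' < k, then per r - k further steps from the common point return to r,
          so r returns after per r - k + k' steps, a positive number below its least period.
          Applying this in both directions gives k = k'.\<close>
        have "k \<le> k'"
          if "(\<tau> ^^ nat k) r = (\<tau> ^^ nat k') r" "r \<in> X" "0 \<le> k" "0 \<le> k'" "k < per r" for k k' :: int and r
        proof (rule ccontr)
          assume "\<not> k \<le> k'"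
          let ?e = "per r - nat k"
          have "(\<tau> ^^ (?e + nat k')) r = (\<tau> ^^ ?e) ((\<tau> ^^ nat k) r)"
            using that(1) by (simp add: funpow_add)
          also have "\<dots> = (\<tau> ^^ (?e + nat k)) r"
            by (simp add: funpow_add)
          also have "?e + nat k = per r"
            using that by linarith
          finally have "(\<tau> ^^ (?e + nat k')) r = r"
            by (simp add: per(2)[OF that(2)])
          then have "per r \<le> ?e + nat k'"
            using that by (intro per_le) auto
          then show False
            using that \<open>\<not> k \<le> k'\<close> by linarith
        qed
        from this[OF _ hR(3)[OF T(2)]] have "k = k'"
          using eq T i j hR(2)[OF T(2)] by (intro antisym) auto
        with i j show "x = y"
          by (simp add: x y)
      qed
      have "x \<in> b ` cycle_model s n m" if x: "x \<in> X" for x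
      proof -
        let ?r = "rep x"
        obtain d where d: "x = (\<tau> ^^ d) ?r"
          using rep_pow(1)[OF x] by blast
        have r: "?r \<in> X" "?r \<in> R"
          using rep_pow(2)[OF x] x by (auto simp: R_def)
        then have "per ?r \<in> n ` {1..s}"
          unfolding n_image P_def by blast
        then obtain i where i: "i \<in> {1..s}" "per ?r = n i"
          by blast
        then have "?r \<in> h i ` {1..m i}"
          using h[of i] r by (simp add: bij_betw_def Rn_def)
        then obtain j where j: "j \<in> {1..m i}" "?r = h i j"
          by blast
        have "(i, j, int (d mod n i)) \<in> cycle_model s n m"
          using i j per(1)[OF r(1)] by (simp add: cycle_model_def flip: of_nat_mod)
        moreover have "b (i, j, int (d mod n i)) = x"
          using d pow_mod[OF r(1), of d] i j by (simp add: b_def)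
        ultimately show ?thesis
          by force
      qed
      moreover have "b ` cycle_model s n m \<subseteq> X"
        using hR(3) by (auto simp: b_def cycle_model_def pow_in)
      ultimately show "b ` cycle_model s n m = X"
        by blast
    qed
    show "b (cycle_step n x) = \<tau> (b x)" if xT: "x \<in> cycle_model s n m" for x
    proof -
      obtain i j k where x: "x = (i, j, k)" and j: "j \<in> {1..m i}" and k: "k \<in> {0..<int (n i)}"
        using xT by (auto simp: cycle_model_def)
      have "nat ((k + 1) mod int (n i)) = (nat k + 1) mod n i"
        using k by (simp add: nat_mod_distrib nat_add_distrib)
      then have "b (cycle_step n x) = (\<tau> ^^ ((nat k + 1) mod per (h i j))) (h i j)"
        by (simp add: x b_def cycle_step_def hR(2)[OF j])
      also have "\<dots> = (\<tau> ^^ (nat k + 1)) (h i j)"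
        by (rule pow_mod[OF hR(3)[OF j], symmetric])
      finally show ?thesis
        by (simp add: x b_def)
    qed
  qed
qed

text \<open>The empty set is treated separately because the requirements on s, n and m force the
  model to be nonempty.\<close>

lemma commuting_bijections_gen_sym_product:
  assumes fin: "finite X" and \<tau>: "\<tau> \<in> X \<rightarrow> X"
    and N: "N > 0" "\<And>x. x \<in> X \<Longrightarrow> (\<tau> ^^ N) x = x"
  shows "\<exists>s n m. s \<ge> 1 \<and> strict_mono_on {1..s} n \<and> (\<forall>i\<in>{1..s}. n i \<ge> 1 \<and> m i \<ge> 1) \<and>
    commuting_bijections X \<tau> \<cong> gen_sym_product s n m"
proof (cases "X = {}")
  case True
  \<comment> \<open>The empty set and a single fixed point both have the trivial group \<open>S(1, 1)\<close>.\<close>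
  let ?s = "1 :: nat" and ?n = "\<lambda>_::nat. 1 :: nat" and ?m = "\<lambda>_::nat. 1 :: nat"
  let ?T = "cycle_model ?s ?n ?m"
  have carrier: "card (carrier (commuting_bijections S \<rho>)) = 1" if "S = {} \<or> S = {x}" "\<rho> \<in> S \<rightarrow> S"
    for S :: "'s set" and \<rho> x
  proof -
    have "carrier (commuting_bijections S \<rho>) = {\<lambda>y\<in>S. y}"
      using that by (auto simp: carrier_commuting_bijections bij_betw_def intro!: extensionalityI[of _ S])
    then show ?thesis
      by simp
  qed
  have "?T = {(1, 1, 0)}"
    by (auto simp: cycle_model_def)
  then have "commuting_bijections X \<tau> \<cong> commuting_bijections ?T (cycle_step ?n)"
    using True \<tau> cycle_step_in[of ?n ?s ?m]
    by (intro singleton_groups_iso group_commuting_bijections carrier) auto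
  also have "commuting_bijections ?T (cycle_step ?n) \<cong> gen_sym_product ?s ?n ?m"
    by (rule commuting_bijections_cycle_model) auto
  finally (iso_trans) show ?thesis
    by (intro exI[of _ ?s] exI[of _ ?n] exI[of _ ?m]) (auto simp: strict_mono_on_def)
next
  case False
  obtain s n m b where snm: "s \<ge> 1" "strict_mono_on {1..s} n" "\<forall>i\<in>{1..s}. n i \<ge> 1 \<and> m i \<ge> 1"
    and b: "bij_betw b (cycle_model s n m) X"
    and step: "\<And>x. x \<in> cycle_model s n m \<Longrightarrow> b (cycle_step n x) = \<tau> (b x)"
    using cycle_model_exists[OF fin False \<tau> N] by metis
  let ?K = "commuting_bijections (cycle_model s n m) (cycle_step n)"
  have "?K \<cong> commuting_bijections X \<tau>"
    by (rule commuting_bijections_conjugate[OF b cycle_step_in \<tau> step])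
  then have "commuting_bijections X \<tau> \<cong> ?K"
    by (rule group.iso_sym[OF group_commuting_bijections[OF cycle_step_in]])
  also have "?K \<cong> gen_sym_product s n m"
    using snm by (intro commuting_bijections_cycle_model strict_mono_on_imp_inj_on) auto
  finally (iso_trans) show ?thesis
    using snm by blast
qed

section \<open>Shifts with finitely many automorphisms\<close>

lemma funpow_shift_map: "(shift_map ^^ k) x = (\<lambda>t. x (t + int k))"
  by (induction k) (auto simp: shift_map_def fun_eq_iff ac_simps)

lemma topspace_full_shift_topology: "topspace (full_shift_topology A) = {x. range x \<subseteq> A}"
  by (auto simp: full_shift_topology_def PiE_UNIV_domain)

lemma Hausdorff_full_shift_topology: "Hausdorff_space (full_shift_topology A)"
  by (simp add: full_shift_topology_def Hausdorff_space_product_topology)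

lemma compact_full_shift_topology: "finite A \<Longrightarrow> compact_space (full_shift_topology A)"
  by (simp add: full_shift_topology_def compact_space_product_topology compact_space_discrete_topology)

text \<open>A continuous bijection of a compact Hausdorff space onto itself is a homeomorphism, so
  continuity of the inverse comes for free.\<close>

lemma funpow_shift_map_in_shift_auts:
  assumes X: "is_shift A X"
  shows "restrict (shift_map ^^ k) X \<in> shift_auts A X"
proof -
  let ?T = "full_shift_topology A"
  have image: "(shift_map ^^ k) ` X = X"
  proof (induction k)
    case (Suc k)
    then show ?case
      using X by (simp only: funpow.simps image_comp [symmetric] is_shift_def)
  qed simp
  have inj: "inj_on (shift_map ^^ k) X"
  proof (rule inj_onI)
    fix x y assume "(shift_map ^^ k) x = (shift_map ^^ k) y"
    then have "x (t - int k + int k) = y (t - int k + int k)" for t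
      unfolding funpow_shift_map by (rule fun_cong)
    then show "x = y"
      by auto
  qed
  have closed: "closedin ?T X" and "finite A"
    using X by (auto simp: is_shift_def)
  then have top: "topspace (subtopology ?T X) = X"
    using closedin_subset by auto
  \<comment> \<open>Coordinate t of the shifted sequence is the projection to coordinate t +
    k.\<close>
  have "continuous_map ?T ?T (shift_map ^^ k)"
    unfolding full_shift_topology_def funpow_shift_map[abs_def] continuous_map_componentwise_UNIV
    by (intro allI continuous_map_product_projection) simp
  then have "continuous_map (subtopology ?T X) (subtopology ?T X) (restrict (shift_map ^^ k) X)"
    using image by (auto simp: continuous_map_in_subtopology continuous_map_from_subtopology
        intro: continuous_map_eq[of _ _ "shift_map ^^ k"])
  moreover have "compact_space (subtopology ?T X)"
    using closedin_compact_space[OF compact_full_shift_topology[OF \<open>finite A\<close>] closed]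
    by (simp add: compact_space_subtopology)
  ultimately have "homeomorphic_map (subtopology ?T X) (subtopology ?T X) (restrict (shift_map ^^ k) X)"
    using Hausdorff_full_shift_topology[of A] image inj top
    by (intro continuous_imp_homeomorphic_map) (auto simp: Hausdorff_space_subtopology inj_on_restrict_eq)
  moreover have "restrict (shift_map ^^ k) X \<in> Bij X"
    using image inj by (auto simp: Bij_def bij_betw_def inj_on_restrict_eq)
  moreover have "shift_map x \<in> X" if "x \<in> X" for x
    using that X by (auto simp: is_shift_def)
  ultimately show ?thesis
    by (auto simp: shift_auts_def funpow_swap1)
qed

lemma finite_shift_auts_imp_periodic:
  assumes X: "is_shift A X" and fin: "finite (shift_auts A X)"
  obtains N where "N > 0" "\<And>x. x \<in> X \<Longrightarrow> (shift_map ^^ N) x = x"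
proof -
  have "range (\<lambda>k. restrict (shift_map ^^ k) X) \<subseteq> shift_auts A X"
    using funpow_shift_map_in_shift_auts[OF X] by blast
  then have "\<not> inj (\<lambda>k. restrict (shift_map ^^ k) X)"
    using fin finite_subset finite_imageD infinite_UNIV_nat by blast
  then obtain k l where "k \<noteq> l" and "restrict (shift_map ^^ k) X = restrict (shift_map ^^ l) X"
    by (auto simp: inj_def)
  then obtain k l where "k < l" and eq: "restrict (shift_map ^^ k) X = restrict (shift_map ^^ l) X"
    by (metis nat_neq_iff)
  show thesis
  proof
    show "l - k > 0"
      using \<open>k < l\<close> by simp
    fix x assume "x \<in> X"
    then have "(shift_map ^^ k) x = (shift_map ^^ l) x"
      using fun_cong[OF eq, of x] by simp
    \<comment> \<open>Evaluating at t - k cancels the first k shifts, which is possible because the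
      sequences are two-sided.\<close>
    then have "x (t - int k + int k) = x (t - int k + int l)" for t
      unfolding funpow_shift_map by (rule fun_cong)
    then show "(shift_map ^^ (l - k)) x = x"
      using \<open>k < l\<close> by (auto simp: funpow_shift_map fun_eq_iff of_nat_diff algebra_simps)
  qed
qed

text \<open>A sequence of period \<open>N\<close> is determined by a window of \<open>N\<close>
  letters, and a finite alphabet allows only finitely many windows.\<close>

lemma finite_periodic_shift:
  assumes X: "is_shift A X" and N: "N > 0" "\<And>x. x \<in> X \<Longrightarrow> (shift_map ^^ N) x = x"
  shows "finite X"
proof -
  have "inj_on (\<lambda>x. restrict x {0..<int N}) X"
  proof (rule inj_onI)
    fix x y assume xy: "x \<in> X" "y \<in> X" "restrict x {0..<int N} = restrict y {0..<int N}"
    \<comment> \<open>Periodicity is available only for forward translations, so for negative t one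
      moves forward from t to its residue, and otherwise from the residue to t.\<close>
    have per: "z (t mod int N) = z t" if "z \<in> X" for z t
    proof -
      have shift: "z (t + int N) = z t" for t
        using N(2)[OF that] by (metis funpow_shift_map)
      have plus: "z (t + int d * int N) = z t" for t d
      proof (induction d)
        case (Suc d)
        have "t + int (Suc d) * int N = t + int d * int N + int N"
          by (simp add: algebra_simps)
        then show ?case
          using shift[of "t + int d * int N"] Suc by metis
      qed simp
      show ?thesis
      proof (cases "t div int N \<ge> 0")
        case True
        then show ?thesis
          using plus[of "t mod int N" "nat (t div int N)"] by simp
      next
        case False
        then show ?thesis
          using plus[of t "nat (- (t div int N))"] by (simp add: minus_div_mult_eq_mod)
      qed
    qed
    have "x (t mod int N) = y (t mod int N)" for t
      using fun_cong[OF xy(3), of "t mod int N"] N(1) by simp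
    then show "x = y"
      using per xy by (metis ext)
  qed
  moreover have "(\<lambda>x. restrict x {0..<int N}) ` X \<subseteq> {0..<int N} \<rightarrow>\<^sub>E A"
    using X closedin_subset[of "full_shift_topology A" X]
    by (fastforce simp: is_shift_def topspace_full_shift_topology)
  moreover have "finite ({0..<int N} \<rightarrow>\<^sub>E A)"
    using X by (auto simp: is_shift_def intro: finite_PiE)
  ultimately show ?thesis
    by (meson finite_imageD finite_subset)
qed

text \<open>A finite Hausdorff space is discrete, so every bijection of \<open>X\<close> is a
  homeomorphism.\<close>

lemma shift_Aut_finite:
  assumes X: "is_shift A X" and fin: "finite X"
  shows "shift_Aut A X = commuting_bijections X shift_map"
proof -
  let ?T = "subtopology (full_shift_topology A) X"
  have "topspace ?T = X"
    using X closedin_subset[of "full_shift_topology A" X]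
    by (simp add: is_shift_def inf.absorb2)
  then have "?T = discrete_topology X"
    using fin Hausdorff_space_subtopology[OF Hausdorff_full_shift_topology]
    by (rule finite_topspace_imp_discrete_topology)
  then have "homeomorphic_map ?T ?T f" if "f \<in> Bij X" for f
    using that by (auto simp: Bij_def bij_betw_def homeomorphic_map_def quotient_map_def)
  then have "shift_auts A X = {f \<in> Bij X. \<forall>x\<in>X. f (shift_map x) = shift_map (f x)}"
    by (auto simp: shift_auts_def)
  then show ?thesis
    by (simp add: shift_Aut_def commuting_bijections_def)
qed

section \<open>Realization by finite shifts\<close>

lemma is_shift_finite:
  assumes "finite A" "finite X" "shift_map ` X = X" "\<And>x. x \<in> X \<Longrightarrow> range x \<subseteq> A"
  shows "is_shift A X"
proof -
  have "X \<subseteq> topspace (full_shift_topology A)"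
    using assms(4) by (auto simp: topspace_full_shift_topology)
  then show ?thesis
    using assms Hausdorff_imp_t1_space[OF Hausdorff_full_shift_topology[of A]]
    by (simp add: is_shift_def t1_space_closedin_finite)
qed

text \<open>Each point becomes the sequence of letters read along its cycle, starting at that point.
  The letter at coordinate 0 identifies the point, so the encoding is injective, and advancing along
  the cycle becomes the shift.\<close>

lemma shift_with_cycle_model:
  assumes n: "\<forall>i\<in>{1..s}. n i \<ge> 1" and inj: "inj_on n {1..s}"
  shows "\<exists>(A :: nat set) X. is_shift A X \<and> shift_Aut A X \<cong> gen_sym_product s n m"
proof -
  let ?T = "cycle_model s n m"
  \<comment> \<open>The letters must be natural numbers. The code is injective on the model because
    positions there are nonnegative, so \<open>nat\<close> loses nothing.\<close>
  define code :: "nat \<times> nat \<times> int \<Rightarrow> nat" where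
    "code = (\<lambda>(i, j, k). prod_encode (i, prod_encode (j, nat k)))"
  define b where "b = (\<lambda>(i, j, k) t. code (i, j, (k + t) mod int (n i)))"
  define X where "X = b ` ?T"
  have fin: "finite ?T"
    by (auto simp: cycle_model_def)
  have step: "b (cycle_step n x) = shift_map (b x)" for x
    by (cases x) (auto simp: b_def shift_map_def cycle_step_def mod_simps ac_simps)
  have b0: "b x 0 = code x" if "x \<in> ?T" for x
    using that by (auto simp: b_def cycle_model_def)
  have "inj_on code ?T"
    by (auto simp: inj_on_def code_def cycle_model_def)
  then have b: "bij_betw b ?T X"
    unfolding X_def using b0 by (metis inj_on_def inj_on_imp_bij_betw)
  have step_surj: "cycle_step n ` ?T = ?T"
  proof (rule endo_inj_surj[OF fin])
    show "cycle_step n ` ?T \<subseteq> ?T"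
      using cycle_step_in by blast
    show "inj_on (cycle_step n) ?T"
    proof (rule inj_on_inverseI)
      show "(\<lambda>(i, j, k). (i, j, (k - 1) mod int (n i))) (cycle_step n x) = x" if "x \<in> ?T" for x
        using that by (auto simp: cycle_step_def cycle_model_def mod_simps)
    qed
  qed
  have "shift_map ` X = b ` cycle_step n ` ?T"
    by (simp add: X_def image_image step)
  then have inv: "shift_map ` X = X"
    by (simp add: step_surj X_def)
  have "b x t \<in> code ` ?T" if "x \<in> ?T" for x t
    using that by (auto simp: b_def cycle_model_def)
  then have X: "is_shift (code ` ?T) X"
    using fin inv by (intro is_shift_finite) (auto simp: X_def)
  moreover have "finite X"
    by (simp add: X_def fin)
  moreover have "commuting_bijections ?T (cycle_step n) \<cong> commuting_bijections X shift_map"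
    using inv step by (intro commuting_bijections_conjugate[OF b cycle_step_in]) auto
  then have "commuting_bijections X shift_map \<cong> commuting_bijections ?T (cycle_step n)"
    by (rule group.iso_sym[OF group_commuting_bijections[OF cycle_step_in]])
  ultimately show ?thesis
    using iso_trans[OF _ commuting_bijections_cycle_model[OF n inj]] by (metis shift_Aut_finite)
qed

theorem theorem7p2:
  fixes G :: "('g, 'r) monoid_scheme"
  assumes "group G" and "finite (carrier G)"
  shows "(\<exists>(A :: nat set) X. is_shift A X \<and> shift_Aut A X \<cong> G) \<longleftrightarrow>
    (\<exists>(s :: nat) (n :: nat \<Rightarrow> nat) (m :: nat \<Rightarrow> nat).
       s \<ge> 1 \<and> strict_mono_on {1..s} n \<and> (\<forall>i\<in>{1..s}. n i \<ge> 1 \<and> m i \<ge> 1) \<and>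
       G \<cong> product_group {1..s} (\<lambda>i. gen_sym_group (n i) (m i)))"
    (is "?L \<longleftrightarrow> ?R")
proof
  assume ?L
  then obtain A :: "nat set" and X where X: "is_shift A X" and iso: "shift_Aut A X \<cong> G"
    by blast
  have "finite (shift_auts A X)"
    using iso_finite[OF iso] assms(2) by (simp add: shift_Aut_def)
  then obtain N where N: "N > 0" "\<And>x. x \<in> X \<Longrightarrow> (shift_map ^^ N) x = x"
    using finite_shift_auts_imp_periodic[OF X] by metis
  have fin: "finite X"
    by (rule finite_periodic_shift[OF X N])
  have \<sigma>: "shift_map \<in> X \<rightarrow> X"
    using X by (auto simp: is_shift_def)
  \<comment> \<open>Reversing the isomorphism requires its source to be a group, which is known for
    \<open>commuting_bijections\<close>.\<close>
  have "commuting_bijections X shift_map \<cong> G"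
    using iso by (simp add: shift_Aut_finite[OF X fin])
  then have G: "G \<cong> commuting_bijections X shift_map"
    by (rule group.iso_sym[OF group_commuting_bijections[OF \<sigma>]])
  obtain s n m where snm: "s \<ge> 1" "strict_mono_on {1..s} n" "\<forall>i\<in>{1..s}. n i \<ge> 1 \<and> m i \<ge> 1"
    and "commuting_bijections X shift_map \<cong> gen_sym_product s n m"
    using commuting_bijections_gen_sym_product[OF fin \<sigma> N] by blast
  then have "G \<cong> gen_sym_product s n m"
    using iso_trans[OF G] by blast
  then show ?R
    using snm by blast
next
  assume ?R
  then obtain s n m where "strict_mono_on {1..s} n" "\<forall>i\<in>{1..s}. n i \<ge> 1"
    and iso: "G \<cong> gen_sym_product s n m"
    by blast
  then obtain A :: "nat set" and X where X: "is_shift A X"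
    and Aut: "shift_Aut A X \<cong> gen_sym_product s n m"
    using shift_with_cycle_model[of s n m] strict_mono_on_imp_inj_on[of "{1..s}" n] by blast
  have "shift_Aut A X \<cong> G"
    by (rule iso_trans[OF Aut group.iso_sym[OF assms(1) iso]])
  with X show ?L
    by blast
qed

end
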